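(* Let $d=1$ and let $(X_1,M_1),\dots,(X_n,M_n)$ be i.i.d. copies of $(X,M)\sim\mathbb{P}_{X,M}$, $X\in\mathbb{R}$, $M\in\{0,1\}$ ($M=0$: $X$ observed), with arbitrary missingness mechanism. Let $\{P_\theta:\theta\in\Theta\}$ be a model on $\mathbb{R}$ and let $\theta_n^{\mathrm{MMD}}$ be a minimizer over $\Theta$ of $\theta\mapsto\frac1n\sum_{i:M_i=0}\mathbb{D}^2(P_\theta,\delta_{\{X_i\}})$ (equivalently, of $\theta\mapsto\mathbb{D}(P_\theta,P_n)$ with $P_n=\frac{1}{|\{i:M_i=0\}|}\sum_{i:M_i=0}\delta_{\{X_i\}}$ when at least one point is observed). Write $\pi(x)=\mathbb{P}[M=0\mid X=x]$ and $\pi=\mathbb{P}[M=0]=\mathbb{E}_{X\sim\mathbb{P}_X}[\pi(X)]>0$. Then $$ \mathbb{E}_{\mathcal{S}}\big[\mathbb{D}(P_{\theta_n^{\mathrm{MMD}}},\mathbb{P}_X)\big]\le\inf_{\theta\in\Theta}\mathbb{D}(P_\theta,\mathbb{P}_X)+\frac{2\sqrt{\mathbb{V}_{X\sim\mathbb{P}_X}[\pi(X)]}}{\pi}+\frac{2\sqrt2}{\sqrt{n\pi}}, $$ where $\mathbb{E}_{\mathcal{S}}$ is the expectation over the sample $\mathcal{S}=\{(X_i,M_i)\}_{1\le i\le n}$.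
   Context: $\mathbb{P}_X$ is the marginal law of $X$. $k$ is a positive definite kernel on $\mathbb{R}$ bounded by $1$ and characteristic, with RKHS $\mathcal{H}$, mean embedding $\Phi(Q)=\mathbb{E}_{Y\sim Q}[k(Y,\cdot)]$ and MMD $\mathbb{D}(Q_1,Q_2)=\|\Phi(Q_1)-\Phi(Q_2)\|_{\mathcal{H}}$. *)

theory Defs
  imports "HOL-Probability.Probability"
begin

definition pd_kernel :: "(real \<Rightarrow> real \<Rightarrow> real) \<Rightarrow> bool" where
  "pd_kernel k \<longleftrightarrow> (\<forall>x y. k x y = k y x) \<and>
     (\<forall>(m::nat) (c::nat \<Rightarrow> real) (x::nat \<Rightarrow> real).
        0 \<le> (\<Sum>i<m. \<Sum>j<m. c i * c j * k (x i) (x j)))"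

text \<open>Squared MMD between two probability measures on the reals: the squared RKHS norm
  of the difference of the kernel mean embeddings, written out via the reproducing property:
  ||Phi Q1 - Phi Q2||^2 = E k(Y,Y') - 2 E k(Y,Z) + E k(Z,Z').\<close>

definition mmd_sq :: "(real \<Rightarrow> real \<Rightarrow> real) \<Rightarrow> real measure \<Rightarrow> real measure \<Rightarrow> real" where
  "mmd_sq k Q1 Q2 =
     (\<integral>x. (\<integral>y. k x y \<partial>Q1) \<partial>Q1) - 2 * (\<integral>x. (\<integral>y. k x y \<partial>Q2) \<partial>Q1)
     + (\<integral>x. (\<integral>y. k x y \<partial>Q2) \<partial>Q2)"

definition mmd :: "(real \<Rightarrow> real \<Rightarrow> real) \<Rightarrow> real measure \<Rightarrow> real measure \<Rightarrow> real" where
  "mmd k Q1 Q2 = sqrt (mmd_sq k Q1 Q2)"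

definition characteristic_kernel :: "(real \<Rightarrow> real \<Rightarrow> real) \<Rightarrow> bool" where
  "characteristic_kernel k \<longleftrightarrow>
     (\<forall>Q1 Q2. prob_space Q1 \<longrightarrow> sets Q1 = sets borel \<longrightarrow>
              prob_space Q2 \<longrightarrow> sets Q2 = sets borel \<longrightarrow>
              mmd k Q1 Q2 = 0 \<longrightarrow> Q1 = Q2)"

text \<open>Joint law Q of (X,M) on real x {0,1}; M = 0 means X observed.\<close>

definition marg_X :: "(real \<times> nat) measure \<Rightarrow> real measure" where
  "marg_X Q = distr Q borel fst"

definition obs_prob :: "(real \<times> nat) measure \<Rightarrow> real" where
  "obs_prob Q = measure Q {\<omega> \<in> space Q. snd \<omega> = 0}"

definition mmd_objective ::
  "(real \<Rightarrow> real \<Rightarrow> real) \<Rightarrow> ('p \<Rightarrow> real measure) \<Rightarrow> nat \<Rightarrow> (nat \<Rightarrow> real \<times> nat) \<Rightarrow> 'p \<Rightarrow> real" where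
  "mmd_objective k P n s \<theta> =
     (1 / real n) * (\<Sum>i\<in>{i. i < n \<and> snd (s i) = 0}. (mmd k (P \<theta>) (return borel (fst (s i))))\<^sup>2)"

end

theory Submission
  imports Defs
begin

text \<open>Write \<open>D\<close> for the MMD, \<open>X\<close> for the law of the covariate, \<open>O\<close> for its law given that it is observed and
  \<open>E\<close> for the empirical law of the observed points. Minimality of the estimator and the triangle inequality
  give \<open>D (P est) X \<le> D (P \<theta>) X + 2 * (D E O + D O X)\<close>. The bias \<open>D O X\<close> is at most the \<open>L\<^sup>1\<close> norm
  of \<open>pix / obs_prob Q - 1\<close>, hence at most its \<open>L\<^sup>2\<close> norm. For the variance, the cross terms of \<open>D E O\<^sup>2\<close>
  have mean zero, so that with \<open>N\<close> observed points its expectation is at most that of \<open>1 / N \<le> 2 / (N + 1)\<close>;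
  finally \<open>E [1 / (N + 1)] \<le> 1 / (n * obs_prob Q)\<close>, by integrating out one point at a time in
  \<open>\<Sum>i. obs i / N \<le> 1\<close>.\<close>

section \<open>Resampling one coordinate of a product measure\<close>

context finite_product_prob_space
begin

lemma resample_measurable:
  assumes i: "i \<in> I" and f: "f \<in> borel_measurable (PiM I M)"
  shows "(\<lambda>(x, y). f (x(i := y))) \<in> borel_measurable (PiM I M \<Otimes>\<^sub>M M i)"
proof -
  have "(\<lambda>z. (fst z)(i := snd z)) \<in> measurable (PiM I M \<Otimes>\<^sub>M M i) (PiM I M)"
    by (rule measurable_fun_upd[where J = I]) (use i in auto)
  from measurable_compose[OF this f] show ?thesis
    by (simp add: case_prod_unfold)
qed

text \<open>Splitting off coordinate \<open>i\<close> on both sides leaves the same iterated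
  integral, since the inner integral does not depend on that coordinate. Asking for \<open>f\<close>
  bounded, rather than integrable, makes every inner integral exist.\<close>

lemma integral_resample:
  fixes f :: "('a \<Rightarrow> 'b) \<Rightarrow> real"
  assumes i: "i \<in> I" and f: "f \<in> borel_measurable (PiM I M)"
    and B: "\<And>x. x \<in> space (PiM I M) \<Longrightarrow> \<bar>f x\<bar> \<le> B"
  shows "(\<integral>x. f x \<partial>PiM I M) = (\<integral>x. (\<integral>y. f (x(i := y)) \<partial>M i) \<partial>PiM I M)"
proof -
  let ?J = "I - {i}" and ?F = "\<lambda>x. \<integral>y. f (x(i := y)) \<partial>M i"
  have fin: "finite ?J" "i \<notin> ?J" "insert i ?J = I" using i finite_index by auto
  have upd: "x(i := y) \<in> space (PiM I M)" if "x \<in> space (PiM I M)" "y \<in> space (M i)" for x y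
    using that i by (auto simp: space_PiM PiE_def extensional_def)
  have F_meas: "?F \<in> borel_measurable (PiM I M)"
    using M.borel_measurable_lebesgue_integral resample_measurable[OF i f] by simp
  have F_bound: "\<bar>?F x\<bar> \<le> B" if x: "x \<in> space (PiM I M)" for x
  proof -
    have m: "(\<lambda>y. f (x(i := y))) \<in> borel_measurable (M i)"
      using measurable_Pair2[OF resample_measurable[OF i f] x] by simp
    have "\<bar>?F x\<bar> \<le> (\<integral>y. \<bar>f (x(i := y))\<bar> \<partial>M i)"
      using integral_norm_bound[of "M i" "\<lambda>y. f (x(i := y))"] by simp
    also have "\<dots> \<le> B"
      using m B[OF upd[OF x]] by (intro M.integral_le_const M.integrable_const_bound[where B = B]) auto
    finally show ?thesis .
  qed
  have int: "integrable (PiM (insert i ?J) M) f" "integrable (PiM (insert i ?J) M) ?F"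
    unfolding fin(3) using f B F_meas F_bound by (auto intro!: integrable_const_bound[where B = B])
  have "(\<integral>x. ?F x \<partial>PiM I M) = (\<integral>x. (\<integral>z. ?F (x(i := z)) \<partial>M i) \<partial>PiM ?J M)"
    using product_integral_insert[OF fin(1,2) int(2)] unfolding fin(3) .
  \<comment> \<open>The second update overrides the first, so the integrand is constant in
    \<open>z\<close>, and \<open>M i\<close> has mass one.\<close>
  also have "\<dots> = (\<integral>x. ?F x \<partial>PiM ?J M)" by (simp add: M.prob_space)
  also have "\<dots> = (\<integral>x. f x \<partial>PiM I M)"
    using product_integral_insert[OF fin(1,2) int(1)] unfolding fin(3) by simp
  finally show ?thesis by simp
qed

text \<open>Distinct coordinates are independent: resampling \<open>j\<close> and then
  \<open>i\<close> leaves a constant under the outer integral.\<close>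

lemma integral_two_components:
  fixes g :: "'b \<Rightarrow> 'b \<Rightarrow> real"
  assumes i: "i \<in> I" and j: "j \<in> I" and ij: "i \<noteq> j"
    and g: "(\<lambda>(x, y). g x y) \<in> borel_measurable (M i \<Otimes>\<^sub>M M j)" and B: "\<And>x y. \<bar>g x y\<bar> \<le> B"
  shows "(\<integral>x. g (x i) (x j) \<partial>PiM I M) = (\<integral>x. (\<integral>y. g x y \<partial>M j) \<partial>M i)"
proof -
  have [measurable]: "(\<lambda>x. \<integral>y. g x y \<partial>M j) \<in> borel_measurable (M i)"
    by (rule M.borel_measurable_lebesgue_integral[OF g])
  have m: "(\<lambda>x. g (x i) (x j)) \<in> borel_measurable (PiM I M)"
    using measurable_compose[OF measurable_Pair[OF measurable_component_singleton[OF i, of M]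
        measurable_component_singleton[OF j, of M]] g] by simp
  have bd: "\<bar>\<integral>y. g x y \<partial>M j\<bar> \<le> B" if "x \<in> space (M i)" for x
  proof -
    have "\<bar>\<integral>y. g x y \<partial>M j\<bar> \<le> (\<integral>y. \<bar>g x y\<bar> \<partial>M j)"
      using integral_norm_bound[of "M j" "\<lambda>y. g x y"] by simp
    also have "\<dots> \<le> B"
      using measurable_Pair2[OF g that] B
      by (intro M.integral_le_const M.integrable_const_bound[where B = B]) auto
    finally show ?thesis .
  qed
  have "(\<integral>x. g (x i) (x j) \<partial>PiM I M) = (\<integral>x. (\<integral>y. g (x i) y \<partial>M j) \<partial>PiM I M)"
    using ij by (subst integral_resample[OF j m B]) simp
  also have "\<dots> = (\<integral>x. (\<integral>z. (\<integral>y. g z y \<partial>M j) \<partial>M i) \<partial>PiM I M)"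
    using i bd by (subst integral_resample[OF i, where B = B]) (auto simp: space_PiM)
  finally show ?thesis by (simp add: P.prob_space)
qed

end

section \<open>MMD of a bounded kernel\<close>

text \<open>Read \<open>p\<close>, \<open>q\<close> as squared norms of two vectors and
  \<open>c\<close> as their inner product. Nonnegativity of the squared norm of every linear
  combination gives Cauchy-Schwarz, and with it the triangle inequality.\<close>

lemma sqrt_triangle_of_quadratic_form:
  fixes p q c :: real
  assumes nn: "\<And>a b. 0 \<le> a\<^sup>2 * p + 2 * a * b * c + b\<^sup>2 * q"
  shows "sqrt (p + 2 * c + q) \<le> sqrt p + sqrt q"
proof -
  have pq: "0 \<le> p" "0 \<le> q" using nn[of 1 0] nn[of 0 1] by auto
  have "c\<^sup>2 \<le> p * q"
  proof (cases "q = 0")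
    case True
    have "c = 0"
    proof (rule ccontr)
      assume "c \<noteq> 0"
      \<comment> \<open>For \<open>q = 0\<close> the form is affine in \<open>b\<close>; this
        \<open>b\<close> gives it the value -1.\<close>
      with nn[of 1 "- (p + 1) / (2 * c)"] True show False by (simp add: field_simps)
    qed
    with pq show ?thesis by simp
  next
    case False
    \<comment> \<open>The minimizing direction is \<open>(q, -c)\<close>, where the form factors in
      this way.\<close>
    have "0 \<le> q * (p * q - c\<^sup>2)"
      using nn[of q "- c"] by (simp add: power2_eq_square algebra_simps)
    with False pq show ?thesis by (simp add: zero_le_mult_iff)
  qed
  hence "c \<le> sqrt (p * q)"
    by (rule real_le_rsqrt)
  hence "p + 2 * c + q \<le> (sqrt p + sqrt q)\<^sup>2"
    using pq by (simp add: power2_sum real_sqrt_mult)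
  thus ?thesis
    using pq by (intro real_le_lsqrt) auto
qed

locale bounded_pd_kernel =
  fixes k :: "real \<Rightarrow> real \<Rightarrow> real"
  assumes pd: "pd_kernel k"
    and k_measurable_pair: "(\<lambda>(x, y). k x y) \<in> borel_measurable (borel \<Otimes>\<^sub>M borel)"
    and k_bound: "\<bar>k x y\<bar> \<le> 1"
begin

text \<open>By the reproducing property, the RKHS inner product of the mean embeddings of
  \<open>U\<close> and \<open>V\<close>. The Hilbert space geometry below is phrased through this
  number.\<close>

definition kip :: "real measure \<Rightarrow> real measure \<Rightarrow> real" where
  "kip U V = (\<integral>x. (\<integral>y. k x y \<partial>V) \<partial>U)"

lemma mmd_sq_kip: "mmd_sq k U V = kip U U - 2 * kip U V + kip V V"
  by (simp add: mmd_sq_def kip_def)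

lemma k_commute: "k x y = k y x"
  using pd by (simp add: pd_kernel_def)

lemma k_measurable [measurable (raw)]:
  assumes "f \<in> borel_measurable M" "g \<in> borel_measurable M"
  shows "(\<lambda>x. k (f x) (g x)) \<in> borel_measurable M"
  using measurable_compose[OF measurable_Pair[OF assms] k_measurable_pair] by simp

text \<open>A function that is not integrable has integral 0 by convention, which \<open>B\<close>
  bounds as well.\<close>

lemma integral_bounded:
  assumes "prob_space U" and "\<And>x. \<bar>f x\<bar> \<le> (B::real)"
  shows "\<bar>\<integral>x. f x \<partial>U\<bar> \<le> B"
proof (cases "integrable U f")
  case True
  interpret prob_space U by fact
  have "\<bar>\<integral>x. f x \<partial>U\<bar> \<le> (\<integral>x. \<bar>f x\<bar> \<partial>U)"
    using integral_norm_bound[of U f] by simp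
  also have "\<dots> \<le> B"
    using True assms(2) by (intro integral_le_const) auto
  finally show ?thesis .
next
  case False
  have "0 \<le> B" using assms(2)[of undefined] by linarith
  with False show ?thesis by (simp add: not_integrable_integral_eq)
qed

lemma kip_bound:
  assumes "prob_space U" "prob_space V"
  shows "\<bar>kip U V\<bar> \<le> 1"
  unfolding kip_def using assms k_bound by (intro integral_bounded) auto

lemma kip_commute:
  assumes "real_distribution U" "real_distribution V"
  shows "kip U V = kip V U"
proof -
  interpret U: real_distribution U by fact
  interpret V: real_distribution V by fact
  interpret UV: pair_prob_space U V ..
  have "integrable (U \<Otimes>\<^sub>M V) (\<lambda>(x, y). k x y)"
    using k_bound by (intro UV.integrable_const_bound[where B = 1]) (auto simp: case_prod_unfold)
  from UV.Fubini_integral[OF this] show ?thesis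
    unfolding kip_def by (simp add: k_commute)
qed

text \<open>Enumerating \<open>A\<close> carries the condition over from initial segments of the
  naturals to any finite index set, such as the pairs (draw, measure) used for sampling
  below.\<close>

lemma k_gram_nonneg:
  assumes "finite A"
  shows "0 \<le> (\<Sum>a\<in>A. \<Sum>b\<in>A. c a * c b * k (x a) (x b))"
proof -
  obtain h where h: "bij_betw h {..<card A} A"
    using ex_bij_betw_nat_finite[OF assms] by (auto simp: atLeast0LessThan)
  have "0 \<le> (\<Sum>i<card A. \<Sum>j<card A. c (h i) * c (h j) * k (x (h i)) (x (h j)))"
    using pd[unfolded pd_kernel_def, THEN conjunct2, THEN spec, THEN spec, THEN spec,
        of "\<lambda>i. c (h i)" "\<lambda>i. x (h i)" "card A"] .
  also have "\<dots> = (\<Sum>a\<in>A. \<Sum>b\<in>A. c a * c b * k (x a) (x b))"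
    by (simp add: sum.reindex_bij_betw[OF h, of "\<lambda>b. c _ * c b * k _ (x b)"]
        sum.reindex_bij_betw[OF h, of "\<lambda>a. \<Sum>b\<in>A. c a * c b * k (x a) (x b)"])
  finally show ?thesis .
qed

text \<open>Positive definiteness passes from points to measures by sampling: draw \<open>m\<close> independent
  points from each \<open>\<mu> p\<close> and take the expectation of the Gram sum. The diagonal terms contribute
  \<open>O(m)\<close> only, against \<open>m\<^sup>2\<close> times the form for the measures.\<close>

lemma kip_gram_nonneg:
  fixes \<mu> :: "nat \<Rightarrow> real measure"
  assumes F: "finite F" and \<mu>: "\<And>p. real_distribution (\<mu> p)"
  shows "0 \<le> (\<Sum>p\<in>F. \<Sum>q\<in>F. a p * a q * kip (\<mu> p) (\<mu> q))" (is "0 \<le> ?S")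
proof -
  have \<mu>_sets [measurable_cong]: "sets (\<mu> p) = sets borel" for p
    using \<mu>[of p] by (simp add: real_distribution_def real_distribution_axioms_def)
  have \<mu>_prob: "prob_space (\<mu> p)" for p
    using \<mu>[of p] by (simp add: real_distribution_def)
  let ?A = "\<Sum>p\<in>F. (a p)\<^sup>2"
  have key: "0 \<le> real m * ?S + 2 * ?A" if m: "m > 0" for m :: nat
  proof -
    \<comment> \<open>Coordinate \<open>(r, p)\<close> is the \<open>r\<close>-th of
      \<open>m\<close> independent draws from \<open>\<mu> p\<close>, weighted by
      \<open>a p\<close>.\<close>
    define I where "I = {..<m} \<times> F"
    define N where "N = (\<lambda>i::nat \<times> nat. \<mu> (snd i))"
    have N_sets [measurable_cong]: "sets (N i) = sets borel" for i
      by (simp add: N_def \<mu>_sets)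
    have I: "finite I" unfolding I_def using F by simp
    interpret finite_product_prob_space N I
      unfolding finite_product_prob_space_def product_prob_space_def
        product_prob_space_axioms_def finite_product_sigma_finite_def
        finite_product_sigma_finite_axioms_def product_sigma_finite_def
      using \<mu>_prob I by (auto simp: N_def intro: prob_space_imp_sigma_finite)
    define c where "c = (\<lambda>i::nat \<times> nat. a (snd i))"
    have int: "integrable (PiM I N) (\<lambda>x. c i * c j * k (x i) (x j))" if "i \<in> I" "j \<in> I" for i j
      using that k_bound by (intro integrable_mult_right integrable_const_bound[where B = 1]) auto
    \<comment> \<open>On the diagonal, the expectation of \<open>k (x i) (x i)\<close> and
      \<open>kip (N i) (N i)\<close> both lie in [-1, 1], so exchanging them costs at most
      \<open>2 * (c i)^2\<close>. Off the diagonal the two agree by independence.\<close>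
    have le: "(\<integral>x. c i * c j * k (x i) (x j) \<partial>PiM I N)
        \<le> c i * c j * kip (N i) (N j) + (if i = j then 2 * (c i)\<^sup>2 else 0)"
      if ij: "i \<in> I" "j \<in> I" for i j
    proof (cases "i = j")
      case True
      have "\<bar>\<integral>x. k (x i) (x i) \<partial>PiM I N\<bar> \<le> 1"
        using k_bound prob_space_axioms by (intro integral_bounded) auto
      moreover have "\<bar>kip (N i) (N i)\<bar> \<le> 1"
        using \<mu>_prob by (intro kip_bound) (auto simp: N_def)
      ultimately have "(c i)\<^sup>2 * ((\<integral>x. k (x i) (x i) \<partial>PiM I N) - kip (N i) (N i)) \<le> (c i)\<^sup>2 * 2"
        by (intro mult_left_mono) auto
      with True show ?thesis by (simp add: power2_eq_square algebra_simps)
    next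
      case False
      have "(\<integral>x. k (x i) (x j) \<partial>PiM I N) = kip (N i) (N j)"
        unfolding kip_def using ij False k_bound
        by (intro integral_two_components) (auto simp: case_prod_unfold)
      with False show ?thesis by simp
    qed
    have "0 \<le> (\<integral>x. (\<Sum>i\<in>I. \<Sum>j\<in>I. c i * c j * k (x i) (x j)) \<partial>PiM I N)"
      by (intro Bochner_Integration.integral_nonneg k_gram_nonneg I)
    also have "\<dots> = (\<Sum>i\<in>I. \<Sum>j\<in>I. (\<integral>x. c i * c j * k (x i) (x j) \<partial>PiM I N))"
      using int
      by (simp only: Bochner_Integration.integral_sum Bochner_Integration.integrable_sum cong: sum.cong)
    also have "\<dots> \<le> (\<Sum>i\<in>I. \<Sum>j\<in>I. c i * c j * kip (N i) (N j) + (if i = j then 2 * (c i)\<^sup>2 else 0))"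
      by (intro sum_mono le)
    also have "\<dots> = (\<Sum>i\<in>I. \<Sum>j\<in>I. c i * c j * kip (N i) (N j)) + (\<Sum>i\<in>I. 2 * (c i)\<^sup>2)"
      using I by (simp add: sum.distrib)
    also have "(\<Sum>i\<in>I. 2 * (c i)\<^sup>2) = real m * (2 * ?A)"
      unfolding I_def c_def by (simp add: sum.cartesian_product' sum_distrib_left)
    also have "(\<Sum>i\<in>I. \<Sum>j\<in>I. c i * c j * kip (N i) (N j)) = real m * (real m * ?S)"
      unfolding I_def c_def N_def
      by (simp add: sum.cartesian_product' sum_distrib_left algebra_simps)
    finally have "0 \<le> real m * (real m * ?S + 2 * ?A)" by (simp add: algebra_simps)
    with m show ?thesis by (simp add: zero_le_mult_iff)
  qed
  show ?thesis
  proof (rule ccontr)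
    assume "\<not> 0 \<le> ?S"
    hence neg: "?S < 0" by simp
    \<comment> \<open>Beyond this threshold \<open>m * ?S\<close> outweighs the cost of the diagonal
      and contradicts \<open>key\<close>.\<close>
    obtain m :: nat where m: "real m > 2 * ?A / (- ?S)" using reals_Archimedean2 by blast
    have "0 \<le> 2 * ?A / (- ?S)" using neg by (intro divide_nonneg_pos) (auto intro: sum_nonneg)
    with m have "m > 0" by (cases m) auto
    from key[OF this] m neg show False by (simp add: field_simps)
  qed
qed

text \<open>The Gram form of the pair \<open>U\<close>, \<open>V\<close> with weights 1 and
  -1.\<close>

lemma mmd_sq_nonneg:
  assumes "real_distribution U" "real_distribution V"
  shows "0 \<le> mmd_sq k U V"
proof -
  have "real_distribution (if p = 0 then U else V)" for p :: nat
    using assms by simp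
  from kip_gram_nonneg[where \<mu> = "\<lambda>p. if p = 0 then U else V", OF _ this,
      of "{..<2}" "\<lambda>p. if p = 0 then 1 else -1"] kip_commute[OF assms]
  show ?thesis by (simp add: mmd_sq_kip numeral_2_eq_2)
qed

lemma mmd_triangle:
  assumes U: "real_distribution U" and V: "real_distribution V" and W: "real_distribution W"
  shows "mmd k U W \<le> mmd k U V + mmd k V W"
proof -
  \<comment> \<open>The inner product of \<open>U - V\<close> and \<open>V - W\<close>, writing
    measures for their embeddings.\<close>
  let ?c = "kip U V - kip U W - kip V V + kip V W"
  note comm = kip_commute[OF V U] kip_commute[OF W V] kip_commute[OF W U]
  have distr: "real_distribution (if p = 0 then U else if p = 1 then V else W)" for p :: nat
    using assms by simp
  \<comment> \<open>The combination \<open>a (U - V) + b (V - W)\<close> gives \<open>U\<close>,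
    \<open>V\<close>, \<open>W\<close> the weights \<open>a\<close>, \<open>b - a\<close>,
    \<open>-b\<close>.\<close>
  have "0 \<le> a\<^sup>2 * mmd_sq k U V + 2 * a * b * ?c + b\<^sup>2 * mmd_sq k V W" for a b :: real
    using kip_gram_nonneg[where \<mu> = "\<lambda>p. if p = 0 then U else if p = 1 then V else W", OF _ distr,
        of "{..<3}" "\<lambda>p. if p = 0 then a else if p = 1 then b - a else - b"] comm
    by (simp add: mmd_sq_kip numeral_3_eq_3 power2_eq_square algebra_simps)
  from sqrt_triangle_of_quadratic_form[OF this]
  show ?thesis by (simp add: mmd_def mmd_sq_kip algebra_simps)
qed

lemma mmd_commute:
  assumes "real_distribution U" "real_distribution V"
  shows "mmd k U V = mmd k V U"
  using kip_commute[OF assms] by (simp add: mmd_def mmd_sq_kip)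

lemma mmd_nonneg:
  assumes "real_distribution U" "real_distribution V"
  shows "0 \<le> mmd k U V"
  using mmd_sq_nonneg[OF assms] by (simp add: mmd_def)

lemma mmd_power2:
  assumes "real_distribution U" "real_distribution V"
  shows "(mmd k U V)\<^sup>2 = mmd_sq k U V"
  using mmd_sq_nonneg[OF assms] by (simp add: mmd_def)

lemma mmd_le_2:
  assumes "prob_space U" "prob_space V"
  shows "mmd k U V \<le> 2"
  using kip_bound[OF assms] kip_bound[OF assms(1,1)] kip_bound[OF assms(2,2)]
  unfolding mmd_def mmd_sq_kip by (intro real_le_lsqrt) auto

end

section \<open>Empirical measures and the centred kernel\<close>

definition empirical :: "nat set \<Rightarrow> (nat \<Rightarrow> real) \<Rightarrow> real measure" where
  "empirical I x = distr (measure_pmf (pmf_of_set I)) borel x"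

text \<open>Unconditional, because the pushforward of a pmf is a probability law for any
  \<open>I\<close>. It is the average of point masses only for finite nonempty
  \<open>I\<close>.\<close>

lemma real_distribution_empirical: "real_distribution (empirical I x)"
  unfolding empirical_def real_distribution_def real_distribution_axioms_def
  by (simp add: measure_pmf.prob_space_distr)

lemma integral_empirical:
  fixes h :: "real \<Rightarrow> real"
  assumes "finite I" "I \<noteq> {}" "h \<in> borel_measurable borel"
  shows "(\<integral>y. h y \<partial>empirical I x) = (\<Sum>i\<in>I. h (x i)) / real (card I)"
  unfolding empirical_def using assms by (subst integral_distr) (auto simp: integral_pmf_of_set)

lemma real_distribution_return: "real_distribution (return borel x)"
  unfolding real_distribution_def real_distribution_axioms_def
  by (simp add: prob_space_return)

context bounded_pd_kernel
begin

text \<open>As a function of \<open>x\<close>, this is the mean embedding of \<open>V\<close>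
  itself.\<close>

definition kmean :: "real measure \<Rightarrow> real \<Rightarrow> real" where
  "kmean V x = (\<integral>y. k x y \<partial>V)"

lemma kip_kmean: "kip U V = (\<integral>x. kmean V x \<partial>U)"
  by (simp add: kip_def kmean_def)

lemma kmean_measurable [measurable]:
  assumes "real_distribution V"
  shows "kmean V \<in> borel_measurable borel"
proof -
  interpret real_distribution V by fact
  show ?thesis unfolding kmean_def by measurable
qed

lemma kmean_bound:
  assumes "real_distribution V"
  shows "\<bar>kmean V x\<bar> \<le> 1"
  using assms k_bound unfolding kmean_def
  by (intro integral_bounded) (auto simp: real_distribution_def)

text \<open>The RKHS inner product of the centred features \<open>k x - kmean V\<close> and
  \<open>k y - kmean V\<close>.\<close>

definition kcentered :: "real measure \<Rightarrow> real \<Rightarrow> real \<Rightarrow> real" where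
  "kcentered V x y = k x y - kmean V x - kmean V y + kip V V"

lemma kcentered_measurable [measurable (raw)]:
  assumes V: "real_distribution V" and [measurable]: "f \<in> borel_measurable M" "g \<in> borel_measurable M"
  shows "(\<lambda>x. kcentered V (f x) (g x)) \<in> borel_measurable M"
proof -
  note [measurable] = kmean_measurable[OF V]
  show ?thesis unfolding kcentered_def by measurable
qed

lemma kcentered_bound:
  assumes "real_distribution V"
  shows "\<bar>kcentered V x y\<bar> \<le> 4"
proof -
  have "\<bar>kip V V\<bar> \<le> 1"
    using assms by (intro kip_bound) (auto simp: real_distribution_def)
  with k_bound[of x y] kmean_bound[OF assms, of x] kmean_bound[OF assms, of y] show ?thesis
    unfolding kcentered_def by linarith
qed

lemma integral_kcentered:
  assumes V: "real_distribution V"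
  shows "(\<integral>x. kcentered V x y \<partial>V) = 0"
proof -
  interpret real_distribution V by fact
  have V1: "prob UNIV = 1" using prob_space by simp
  note [measurable] = kmean_measurable[OF V]
  have int: "integrable V (\<lambda>x. k x y)" "integrable V (kmean V)"
    using k_bound kmean_bound[OF V] by (auto intro!: integrable_const_bound[where B = 1])
  have "(\<integral>x. k x y \<partial>V) = kmean V y"
    unfolding kmean_def by (rule Bochner_Integration.integral_cong[OF refl k_commute])
  then show ?thesis
    unfolding kcentered_def using int V1 by (simp add: kip_kmean)
qed

text \<open>This is the variance of the feature of a point drawn from \<open>V\<close>, the mean of
  \<open>k x x\<close> minus \<open>kip V V\<close>. Dropping the nonnegative \<open>kip V V\<close>
  leaves 1, where the pointwise bound would give 4.\<close>

lemma integral_kcentered_diag: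
  assumes V: "real_distribution V"
  shows "(\<integral>x. kcentered V x x \<partial>V) \<le> 1"
proof -
  interpret real_distribution V by fact
  have V1: "prob UNIV = 1" using prob_space by simp
  note [measurable] = kmean_measurable[OF V]
  have int: "integrable V (\<lambda>x. k x x)" "integrable V (kmean V)"
    using k_bound kmean_bound[OF V] by (auto intro!: integrable_const_bound[where B = 1])
  have "(\<integral>x. kcentered V x x \<partial>V) = (\<integral>x. k x x \<partial>V) - kip V V"
    unfolding kcentered_def using int V1 by (simp add: kip_kmean)
  moreover have "\<bar>\<integral>x. k x x \<partial>V\<bar> \<le> 1"
    using k_bound prob_space_axioms by (intro integral_bounded) auto
  moreover have "0 \<le> kip V V"
    using kip_gram_nonneg[of "{0}" "\<lambda>_. V" "\<lambda>_. 1"] V by simp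
  ultimately show ?thesis by linarith
qed

lemma mmd_sq_return:
  assumes "real_distribution U"
  shows "mmd_sq k U (return borel x) = kip U U - 2 * kmean U x + k x x"
proof -
  interpret real_distribution U by fact
  have "kip U (return borel x) = (\<integral>y. k y x \<partial>U)"
    unfolding kip_def by (simp add: integral_return)
  also have "\<dots> = kmean U x"
    unfolding kmean_def by (rule Bochner_Integration.integral_cong[OF refl k_commute])
  finally have "kip U (return borel x) = kmean U x" .
  moreover have "kip (return borel x) (return borel x) = k x x"
    unfolding kip_def by (simp add: integral_return)
  ultimately show ?thesis by (simp add: mmd_sq_kip)
qed

lemma kip_empirical:
  assumes I: "finite I" "I \<noteq> {}" and V: "real_distribution V"
  shows "kip (empirical I x) V = (\<Sum>i\<in>I. kmean V (x i)) / card I"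
  unfolding kip_kmean using integral_empirical[OF I kmean_measurable[OF V]] .

lemma kmean_empirical:
  assumes I: "finite I" "I \<noteq> {}"
  shows "kmean (empirical I x) y = (\<Sum>i\<in>I. k y (x i)) / card I"
  unfolding kmean_def using integral_empirical[OF I, of "\<lambda>z. k y z"] by simp

text \<open>The embedding of the empirical law minus that of \<open>V\<close> is the average of the
  centred features; its squared norm is expanded.\<close>

lemma mmd_sq_empirical:
  assumes I: "finite I" "I \<noteq> {}" and V: "real_distribution V"
  shows "mmd_sq k (empirical I x) V = (\<Sum>i\<in>I. \<Sum>j\<in>I. kcentered V (x i) (x j)) / (real (card I))\<^sup>2"
proof -
  have N: "real (card I) > 0" using I by (simp add: card_gt_0_iff)
  have "(\<Sum>i\<in>I. \<Sum>j\<in>I. kcentered V (x i) (x j)) =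
      (\<Sum>i\<in>I. \<Sum>j\<in>I. k (x i) (x j)) - 2 * card I * (\<Sum>i\<in>I. kmean V (x i)) + (card I)\<^sup>2 * kip V V"
    unfolding kcentered_def
    by (simp add: sum.distrib sum_subtractf power2_eq_square flip: sum_distrib_left)
  with N show ?thesis
    unfolding mmd_sq_kip kip_empirical[OF I V] kip_empirical[OF I real_distribution_empirical]
      kmean_empirical[OF I]
    by (simp add: field_simps power2_eq_square sum_divide_distrib[symmetric])
qed

text \<open>Decomposition of a mean squared distance around the barycentre. Only the first summand
  depends on \<open>\<theta>\<close>, so once a point is observed, minimizing the objective means
  minimizing the MMD to the empirical law.\<close>

lemma mmd_objective_empirical:
  assumes I: "I = {i. i < n \<and> snd (s i) = 0}" "I \<noteq> {}" and P: "real_distribution (P \<theta>)"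
  shows "mmd_objective k P n s \<theta> =
    (card I / n) * mmd_sq k (P \<theta>) (empirical I (\<lambda>i. fst (s i)))
    + ((\<Sum>i\<in>I. k (fst (s i)) (fst (s i))) - card I * kip (empirical I (\<lambda>i. fst (s i))) (empirical I (\<lambda>i. fst (s i)))) / n"
proof -
  let ?E = "empirical I (\<lambda>i. fst (s i))"
  have fin: "finite I" using I by simp
  hence N: "real (card I) > 0" using I(2) by (simp add: card_gt_0_iff)
  have "(mmd k (P \<theta>) (return borel z))\<^sup>2 = kip (P \<theta>) (P \<theta>) - 2 * kmean (P \<theta>) z + k z z" for z
    using P by (simp add: mmd_power2 real_distribution_return mmd_sq_return)
  hence "mmd_objective k P n s \<theta> =
      (card I * kip (P \<theta>) (P \<theta>) - 2 * (\<Sum>i\<in>I. kmean (P \<theta>) (fst (s i))) + (\<Sum>i\<in>I. k (fst (s i)) (fst (s i)))) / n"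
    unfolding mmd_objective_def I(1)[symmetric]
    by (simp add: sum.distrib sum_subtractf sum_distrib_left)
  also have "(\<Sum>i\<in>I. kmean (P \<theta>) (fst (s i))) = card I * kip (P \<theta>) ?E"
    using N by (simp add: kip_commute[OF P real_distribution_empirical] kip_empirical[OF fin I(2) P])
  finally show ?thesis
    by (simp add: mmd_sq_kip algebra_simps diff_divide_distrib add_divide_distrib)
qed

lemma mmd_empirical_le_of_mmd_objective_le:
  assumes I: "I = {i. i < n \<and> snd (s i) = 0}" "I \<noteq> {}"
    and P: "real_distribution (P \<theta>)" "real_distribution (P \<theta>')"
    and le: "mmd_objective k P n s \<theta> \<le> mmd_objective k P n s \<theta>'"
  shows "mmd k (P \<theta>) (empirical I (\<lambda>i. fst (s i))) \<le> mmd k (P \<theta>') (empirical I (\<lambda>i. fst (s i)))"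
proof -
  have "real (card I) > 0" "n > 0" using I by (auto simp: card_gt_0_iff)
  with le show ?thesis
    unfolding mmd_objective_empirical[where P = P and s = s, OF I P(1)]
      mmd_objective_empirical[where P = P and s = s, OF I P(2)]
    by (simp add: mmd_def divide_le_cancel)
qed

end

section \<open>Law of the observed data\<close>

text \<open>Tested on the set where \<open>f\<close> is negative. This form fits \<open>pix\<close>,
  which is known only through its integrals over Borel sets.\<close>

lemma AE_nonneg_of_set_integral_nonneg:
  fixes f :: "'a \<Rightarrow> real"
  assumes f: "integrable M f" and nn: "\<And>A. A \<in> sets M \<Longrightarrow> 0 \<le> (LINT x:A|M. f x)"
  shows "AE x in M. 0 \<le> f x"
proof -
  define A where "A = {x \<in> space M. f x < 0}"
  have [measurable]: "f \<in> borel_measurable M" using f by simp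
  have A: "A \<in> sets M" unfolding A_def by measurable
  let ?g = "\<lambda>x. - (indicator A x * f x)"
  have g: "integrable M ?g" using integrable_mult_indicator[OF A f] by simp
  have g_nn: "0 \<le> ?g x" if "x \<in> space M" for x
    using that by (auto simp: A_def indicator_def)
  have "integral\<^sup>L M ?g \<le> 0"
    using nn[OF A] by (simp add: set_lebesgue_integral_def)
  moreover have "0 \<le> integral\<^sup>L M ?g"
    using g_nn by (intro Bochner_Integration.integral_nonneg)
  ultimately have "AE x in M. ?g x = 0"
    using integral_nonneg_eq_0_iff_AE[OF g] g_nn by (simp add: AE_I2)
  with AE_space show ?thesis
    by eventually_elim (auto simp: A_def indicator_def split: if_splits)
qed

text \<open>\<open>pix\<close> is any version of the conditional probability of being observed given
  \<open>X\<close>, with \<open>pix_cond\<close> as its defining property. Its values are therefore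
  confined to [0, 1] only almost everywhere.\<close>

locale missing_data = Q: prob_space Q for Q :: "(real \<times> nat) measure" +
  fixes pix :: "real \<Rightarrow> real"
  assumes Q_sets: "sets Q = sets (borel \<Otimes>\<^sub>M count_space {0, 1})"
    and pix_measurable [measurable]: "pix \<in> borel_measurable borel"
    and pix_integrable: "integrable (marg_X Q) pix"
    and pix_cond: "A \<in> sets borel \<Longrightarrow> measure Q (A \<times> {0}) = (LINT x:A | marg_X Q. pix x)"
    and obs_pos: "obs_prob Q > 0"
begin

lemma space_Q: "space Q = UNIV \<times> {0, 1}"
  using sets_eq_imp_space_eq[OF Q_sets] by (simp add: space_pair_measure)

lemma fst_measurable [measurable]: "fst \<in> borel_measurable Q"
  unfolding measurable_cong_sets[OF Q_sets refl] by measurable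

definition obs :: "real \<times> nat \<Rightarrow> real" where
  "obs \<omega> = of_bool (snd \<omega> = 0)"

lemma obs_measurable [measurable]: "obs \<in> borel_measurable Q"
  unfolding measurable_cong_sets[OF Q_sets refl] obs_def by measurable

lemma obs_bounds: "0 \<le> obs \<omega>" "obs \<omega> \<le> 1"
  by (auto simp: obs_def)

sublocale PX: real_distribution "marg_X Q"
  unfolding real_distribution_def real_distribution_axioms_def marg_X_def
  by (simp add: Q.prob_space_distr)

lemma pix_nonneg: "AE x in marg_X Q. 0 \<le> pix x"
  using pix_integrable
  by (rule AE_nonneg_of_set_integral_nonneg) (simp flip: pix_cond)

lemma pix_le_1: "AE x in marg_X Q. pix x \<le> 1"
proof -
  have "AE x in marg_X Q. 0 \<le> 1 - pix x"
  proof (rule AE_nonneg_of_set_integral_nonneg)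
    fix A assume "A \<in> sets (marg_X Q)"
    hence A: "A \<in> sets borel" by simp
    have int: "set_integrable (marg_X Q) A (\<lambda>x. 1::real)" "set_integrable (marg_X Q) A pix"
      unfolding set_integrable_def using A integrable_mult_indicator[OF _ pix_integrable, of A]
      by (auto simp: PX.emeasure_eq_measure)
    have "measure Q (A \<times> {0}) \<le> measure Q (fst -` A \<inter> space Q)"
      using A by (intro Q.finite_measure_mono measurable_sets[OF fst_measurable]) (auto simp: space_Q)
    also have "\<dots> = measure (marg_X Q) A"
      unfolding marg_X_def using A by (simp add: measure_distr)
    also have "\<dots> = (LINT x:A | marg_X Q. 1)"
      unfolding set_lebesgue_integral_def using A by simp
    finally show "0 \<le> (LINT x:A | marg_X Q. 1 - pix x)"
      using int pix_cond[OF A] by simp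
  qed (use pix_integrable in simp)
  then show ?thesis by simp
qed

text \<open>On Borel sets this is \<open>pix_cond\<close>. As an equality of measures it passes at
  once to integrals of measurable test functions.\<close>

lemma distr_observed: "distr (density Q (\<lambda>\<omega>. ennreal (obs \<omega>))) borel fst = density (marg_X Q) pix"
proof (rule measure_eqI)
  fix A assume "A \<in> sets (distr (density Q (\<lambda>\<omega>. ennreal (obs \<omega>))) borel fst)"
  hence A [measurable]: "A \<in> sets borel" by simp
  have A0: "A \<times> {0} \<in> sets Q" unfolding Q_sets using A by auto
  have "emeasure (distr (density Q (\<lambda>\<omega>. ennreal (obs \<omega>))) borel fst) A =
      emeasure (density Q (\<lambda>\<omega>. ennreal (obs \<omega>))) (fst -` A \<inter> space Q)"
    by (subst emeasure_distr) auto
  also have "\<dots> = (\<integral>\<^sup>+\<omega>. ennreal (obs \<omega>) * indicator (fst -` A \<inter> space Q) \<omega> \<partial>Q)"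
    by (subst emeasure_density) auto
  also have "\<dots> = (\<integral>\<^sup>+\<omega>. indicator (A \<times> {0}) \<omega> \<partial>Q)"
    by (intro nn_integral_cong) (auto simp: obs_def indicator_def)
  also have "\<dots> = ennreal (measure Q (A \<times> {0}))"
    using A0 by (simp add: Q.emeasure_eq_measure)
  also have "\<dots> = ennreal (\<integral>x. indicator A x * pix x \<partial>marg_X Q)"
    using pix_cond[OF A] by (simp add: set_lebesgue_integral_def)
  also have "\<dots> = (\<integral>\<^sup>+x. ennreal (indicator A x * pix x) \<partial>marg_X Q)"
    using pix_nonneg integrable_mult_indicator[OF _ pix_integrable, of A]
    by (intro nn_integral_eq_integral[symmetric]) auto
  also have "\<dots> = emeasure (density (marg_X Q) pix) A"
    by (subst emeasure_density) (auto intro!: nn_integral_cong simp: indicator_def)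
  finally show "emeasure (distr (density Q (\<lambda>\<omega>. ennreal (obs \<omega>))) borel fst) A =
      emeasure (density (marg_X Q) pix) A" .
qed simp

lemma integral_observed:
  assumes h [measurable]: "h \<in> borel_measurable borel"
  shows "(\<integral>\<omega>. obs \<omega> * h (fst \<omega>) \<partial>Q) = (\<integral>x. pix x * h x \<partial>marg_X Q)"
proof -
  have "(\<integral>\<omega>. obs \<omega> * h (fst \<omega>) \<partial>Q) = (\<integral>\<omega>. h (fst \<omega>) \<partial>density Q (\<lambda>\<omega>. ennreal (obs \<omega>)))"
    by (subst integral_density) (auto simp: obs_bounds)
  also have "\<dots> = (\<integral>x. h x \<partial>density (marg_X Q) pix)"
    unfolding distr_observed[symmetric] by (subst integral_distr) auto
  also have "\<dots> = (\<integral>x. pix x * h x \<partial>marg_X Q)"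
    using pix_nonneg by (subst integral_density) auto
  finally show ?thesis .
qed

lemma integral_obs: "(\<integral>\<omega>. obs \<omega> \<partial>Q) = obs_prob Q"
proof -
  have "{\<omega> \<in> space Q. snd \<omega> = 0} = UNIV \<times> {0}" by (auto simp: space_Q)
  moreover have "UNIV \<times> {0} \<in> sets Q" unfolding Q_sets by auto
  moreover have "(\<integral>\<omega>. obs \<omega> \<partial>Q) = (\<integral>\<omega>. indicator (UNIV \<times> {0}) \<omega> \<partial>Q)"
    by (intro Bochner_Integration.integral_cong) (auto simp: obs_def indicator_def)
  ultimately show ?thesis by (simp add: obs_prob_def)
qed

lemma integral_pix: "(\<integral>x. pix x \<partial>marg_X Q) = obs_prob Q"
  using integral_observed[of "\<lambda>_. 1"] integral_obs by simp

text \<open>By Bayes' rule, the law of \<open>X\<close> given \<open>M = 0\<close>.\<close>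

definition observed_law :: "real measure" where
  "observed_law = density (marg_X Q) (\<lambda>x. ennreal (pix x / obs_prob Q))"

lemma integral_observed_law:
  assumes "h \<in> borel_measurable borel"
  shows "(\<integral>x. h x \<partial>observed_law) = (\<integral>x. pix x / obs_prob Q * h x \<partial>marg_X Q)"
  unfolding observed_law_def using assms pix_nonneg obs_pos
  by (subst integral_density) auto

lemma integral_obs_observed_law:
  assumes "h \<in> borel_measurable borel"
  shows "(\<integral>\<omega>. obs \<omega> * h (fst \<omega>) \<partial>Q) = obs_prob Q * (\<integral>x. h x \<partial>observed_law)"
  using obs_pos integral_observed[OF assms] integral_observed_law[OF assms] by simp

lemma real_distribution_observed_law: "real_distribution observed_law"
proof -
  have "emeasure observed_law (space observed_law) = (\<integral>\<^sup>+x. ennreal (pix x / obs_prob Q) \<partial>marg_X Q)"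
    unfolding observed_law_def by (subst emeasure_density) (auto intro!: nn_integral_cong)
  also have "\<dots> = ennreal (\<integral>x. pix x / obs_prob Q \<partial>marg_X Q)"
    using pix_integrable pix_nonneg obs_pos by (intro nn_integral_eq_integral) auto
  also have "\<dots> = 1" using obs_pos integral_pix by simp
  finally show ?thesis
    unfolding real_distribution_def real_distribution_axioms_def
    by (auto intro: prob_spaceI simp: observed_law_def)
qed

end

section \<open>Bias caused by the missingness mechanism\<close>

locale missing_data_kernel = missing_data Q pix + bounded_pd_kernel k for Q pix k
begin

text \<open>The difference of the two embeddings has density \<open>g = pix / obs_prob Q - 1\<close> against the law
  of \<open>X\<close>, so its norm is at most the \<open>L\<^sup>1\<close> norm of \<open>g\<close>.\<close>

lemma mmd_observed_law_le:
  "mmd k observed_law (marg_X Q) \<le> sqrt (\<integral>x. (pix x - obs_prob Q)\<^sup>2 \<partial>marg_X Q) / obs_prob Q"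
proof -
  let ?\<pi> = "obs_prob Q" and ?X = "marg_X Q" and ?O = observed_law
  note O = real_distribution_observed_law and X = PX.real_distribution_axioms
  note [measurable] = kmean_measurable[OF O] kmean_measurable[OF X]
  define g where "g x = pix x / ?\<pi> - 1" for x
  define G where "G = (\<integral>x. \<bar>g x\<bar> \<partial>?X)"
  have [measurable]: "g \<in> borel_measurable borel" unfolding g_def by measurable
  have g_int: "integrable ?X g" unfolding g_def using pix_integrable by simp
  have diff: "(\<integral>x. h x \<partial>?O) - (\<integral>x. h x \<partial>?X) = (\<integral>x. g x * h x \<partial>?X)"
    if h [measurable]: "h \<in> borel_measurable borel" and B: "\<And>x. \<bar>h x\<bar> \<le> B" for h B
  proof -
    have "integrable ?X h" using B by (intro PX.integrable_const_bound[where B = B]) auto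
    moreover have "integrable ?X (\<lambda>x. pix x / ?\<pi> * h x)"
    proof (rule Bochner_Integration.integrable_bound)
      show "integrable ?X (\<lambda>x. B * (pix x / ?\<pi>))" using pix_integrable by simp
      have "B \<ge> 0" using B[of 0] by linarith
      then show "AE x in ?X. norm (pix x / ?\<pi> * h x) \<le> norm (B * (pix x / ?\<pi>))"
        using mult_right_mono[OF B, of "\<bar>pix x / ?\<pi>\<bar>" for x]
        by (intro AE_I2) (simp add: abs_mult mult.commute)
    qed simp
    ultimately show ?thesis
      using integral_observed_law[OF h] by (simp add: g_def algebra_simps)
  qed
  define d where "d x = kmean ?O x - kmean ?X x" for x
  have d_meas [measurable]: "d \<in> borel_measurable borel" unfolding d_def by measurable
  have d_bound: "\<bar>d x\<bar> \<le> G" for x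
  proof -
    have "d x = (\<integral>y. g y * k x y \<partial>?X)"
      unfolding d_def kmean_def using diff[of "\<lambda>y. k x y", OF _ k_bound] by simp
    also have "\<bar>\<dots>\<bar> \<le> (\<integral>y. \<bar>g y * k x y\<bar> \<partial>?X)"
      using integral_norm_bound[of ?X "\<lambda>y. g y * k x y"] by simp
    also have "\<dots> \<le> G" unfolding G_def
    proof (rule integral_mono_AE')
      show "integrable ?X (\<lambda>y. \<bar>g y\<bar>)" using g_int by simp
      show "AE y in ?X. \<bar>g y * k x y\<bar> \<le> \<bar>g y\<bar>"
        using k_bound by (intro AE_I2) (simp add: abs_mult mult_left_le)
    qed simp
    finally show ?thesis .
  qed
  have int: "integrable U (kmean V)" if "real_distribution U" "real_distribution V" for U V
  proof -
    interpret U: real_distribution U by fact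
    show ?thesis using kmean_bound[OF that(2)] kmean_measurable[OF that(2)]
      by (intro U.integrable_const_bound[where B = 1]) auto
  qed
  \<comment> \<open>The squared norm of the difference \<open>d\<close> of the embeddings is the
    integral of \<open>d\<close> against \<open>observed_law\<close> minus \<open>marg_X Q\<close>.
    With \<open>d_bound\<close>, the L1 norm \<open>G\<close> thus enters twice.\<close>
  have "mmd_sq k ?O ?X = (\<integral>x. d x \<partial>?O) - (\<integral>x. d x \<partial>?X)"
    unfolding d_def mmd_sq_kip using int O X kip_commute[OF O X]
    by (simp add: kip_kmean)
  also have "\<dots> = (\<integral>x. g x * d x \<partial>?X)"
    by (rule diff[OF d_meas d_bound])
  also have "\<dots> \<le> (\<integral>x. \<bar>g x\<bar> * G \<partial>?X)"
  proof (rule integral_mono_AE')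
    show "integrable ?X (\<lambda>x. \<bar>g x\<bar> * G)" using g_int by simp
    have "g x * d x \<le> \<bar>g x\<bar> * G" for x
      using mult_left_mono[OF d_bound[of x] abs_ge_zero[of "g x"]] abs_ge_self[of "g x * d x"]
      by (simp add: abs_mult)
    then show "AE x in ?X. g x * d x \<le> \<bar>g x\<bar> * G" by simp
    have "0 \<le> G" using d_bound[of 0] by linarith
    then show "AE x in ?X. 0 \<le> \<bar>g x\<bar> * G" by simp
  qed
  also have "\<dots> = G\<^sup>2" by (simp add: G_def power2_eq_square)
  \<comment> \<open>Nonnegativity of the variance of \<open>\<bar>g\<bar>\<close>; it is square
    integrable because \<open>pix\<close> lies in [0, 1] almost everywhere.\<close>
  also have "\<dots> \<le> (\<integral>x. (g x)\<^sup>2 \<partial>?X)"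
  proof -
    have "integrable ?X (\<lambda>x. (g x)\<^sup>2)"
    proof (rule PX.integrable_const_bound[where B = "(1 / ?\<pi> + 1)\<^sup>2"])
      show "AE x in ?X. norm ((g x)\<^sup>2) \<le> (1 / ?\<pi> + 1)\<^sup>2"
        using pix_nonneg pix_le_1
      proof eventually_elim
        case (elim x)
        have "0 \<le> pix x / ?\<pi>" "pix x / ?\<pi> \<le> 1 / ?\<pi>"
          using elim obs_pos by (auto intro: divide_right_mono)
        hence "\<bar>g x\<bar> \<le> \<bar>1 / ?\<pi> + 1\<bar>" unfolding g_def by linarith
        from power2_le_iff_abs_le this show ?case by (simp add: abs_le_square_iff)
      qed
    qed simp
    with PX.variance_eq[of "\<lambda>x. \<bar>g x\<bar>"] PX.variance_positive[of "\<lambda>x. \<bar>g x\<bar>"] g_int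
    show ?thesis by (simp add: G_def)
  qed
  also have "\<dots> = (\<integral>x. (pix x - ?\<pi>)\<^sup>2 \<partial>?X) / ?\<pi>\<^sup>2"
  proof -
    have "(g x)\<^sup>2 = (pix x - ?\<pi>)\<^sup>2 / ?\<pi>\<^sup>2" for x
      unfolding g_def using obs_pos by (simp add: power_divide[symmetric] diff_divide_distrib)
    then show ?thesis by simp
  qed
  finally have "mmd k ?O ?X \<le> sqrt ((\<integral>x. (pix x - ?\<pi>)\<^sup>2 \<partial>?X) / ?\<pi>\<^sup>2)"
    unfolding mmd_def by (rule real_sqrt_le_mono)
  with obs_pos show ?thesis by (simp add: real_sqrt_divide)
qed

end

section \<open>Error of the empirical law\<close>

text \<open>Jensen for the square root, by its tangent at \<open>c^2\<close>:
  \<open>sqrt t <= (t / c + c) / 2\<close>. The same inequality supplies integrability.\<close>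

lemma (in prob_space) expectation_sqrt_le:
  assumes T: "integrable M T" and nn: "\<And>x. x \<in> space M \<Longrightarrow> 0 \<le> T x"
    and le: "expectation T \<le> c\<^sup>2" and c: "0 < c"
  shows "integrable M (\<lambda>x. sqrt (T x))" "expectation (\<lambda>x. sqrt (T x)) \<le> c"
proof -
  have am_gm: "sqrt (T x) \<le> (T x / c + c) / 2" if "x \<in> space M" for x
  proof -
    have "0 \<le> (sqrt (T x) - c)\<^sup>2" by simp
    with nn[OF that] have "2 * c * sqrt (T x) \<le> T x + c\<^sup>2" by (simp add: power2_diff algebra_simps)
    with c show ?thesis by (simp add: field_simps power2_eq_square)
  qed
  have int: "integrable M (\<lambda>x. (T x / c + c) / 2)" using T by simp
  have [measurable]: "T \<in> borel_measurable M" using T by simp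
  show sqrt_int: "integrable M (\<lambda>x. sqrt (T x))"
  proof (rule Bochner_Integration.integrable_bound[OF int])
    show "AE x in M. norm (sqrt (T x)) \<le> norm ((T x / c + c) / 2)"
      using am_gm nn by (intro AE_I2) (simp add: order_trans[OF _ abs_ge_self])
  qed simp
  have "expectation (\<lambda>x. sqrt (T x)) \<le> expectation (\<lambda>x. (T x / c + c) / 2)"
    using sqrt_int int am_gm by (rule integral_mono)
  also have "\<dots> = (expectation T / c + c) / 2" using T by (simp add: prob_space)
  also have "\<dots> \<le> c" using le c by (simp add: field_simps power2_eq_square)
  finally show "expectation (\<lambda>x. sqrt (T x)) \<le> c" .
qed

section \<open>The sample and its number of observed points\<close>

locale missing_data_sample = missing_data_kernel Q pix k for Q pix k +
  fixes n :: nat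
  assumes n_pos: "n \<ge> 1"
begin

sublocale S: finite_product_prob_space "\<lambda>_::nat. Q" "{..<n}"
  unfolding finite_product_prob_space_def product_prob_space_def
    product_prob_space_axioms_def finite_product_sigma_finite_def
    finite_product_sigma_finite_axioms_def product_sigma_finite_def
  using Q.prob_space_axioms by (simp add: prob_space_imp_sigma_finite)

abbreviation sample :: "(nat \<Rightarrow> real \<times> nat) measure" where
  "sample \<equiv> PiM {..<n} (\<lambda>_. Q)"

definition nobs :: "(nat \<Rightarrow> real \<times> nat) \<Rightarrow> real" where
  "nobs s = (\<Sum>i<n. obs (s i))"

definition nobs_except :: "nat \<Rightarrow> (nat \<Rightarrow> real \<times> nat) \<Rightarrow> real" where
  "nobs_except i s = (\<Sum>j\<in>{..<n} - {i}. obs (s j))"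

lemma obs_component_measurable [measurable]:
  assumes "i < n"
  shows "(\<lambda>s. obs (s i)) \<in> borel_measurable sample"
  using assms by (intro measurable_compose[OF measurable_component_singleton[of i "{..<n}" "\<lambda>_. Q"]
      obs_measurable]) simp

lemma fst_component_measurable [measurable]:
  assumes "i < n"
  shows "(\<lambda>s. fst (s i)) \<in> borel_measurable sample"
  using assms by (intro measurable_compose[OF measurable_component_singleton[of i "{..<n}" "\<lambda>_. Q"]
      fst_measurable]) simp

lemma nobs_measurable [measurable]: "nobs \<in> borel_measurable sample"
  unfolding nobs_def by (intro borel_measurable_sum obs_component_measurable) simp

lemma nobs_except_measurable [measurable]: "nobs_except i \<in> borel_measurable sample"
  unfolding nobs_except_def by (intro borel_measurable_sum obs_component_measurable) simp

lemma nobs_nonneg: "0 \<le> nobs s"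
  unfolding nobs_def by (intro sum_nonneg obs_bounds)

lemma nobs_except_nonneg: "0 \<le> nobs_except i s"
  unfolding nobs_except_def by (intro sum_nonneg obs_bounds)

lemma nobs_split: "i < n \<Longrightarrow> nobs s = obs (s i) + nobs_except i s"
  unfolding nobs_def nobs_except_def by (subst sum.remove[of _ i]) auto

lemma nobs_upd: "i < n \<Longrightarrow> nobs (s(i := y)) = obs y + nobs_except i s"
  by (simp add: nobs_split) (simp add: nobs_except_def)

lemma nobs_eq_card: "nobs s = card {i. i < n \<and> snd (s i) = 0}"
  unfolding nobs_def obs_def by (simp add: Int_def lessThan_def)

text \<open>If point \<open>i\<close> is observed, \<open>nobs s\<close> is at least 1; otherwise
  the numerator vanishes, and so does the quotient, even where \<open>nobs s = 0\<close>.\<close>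

lemma obs_div_nobs_le:
  assumes "i < n"
  shows "0 \<le> obs (s i) / nobs s ^ e" "obs (s i) / nobs s ^ e \<le> 1"
proof -
  have "obs (s i) = 0 \<or> obs (s i) = 1" by (auto simp: obs_def)
  then show "0 \<le> obs (s i) / nobs s ^ e" "obs (s i) / nobs s ^ e \<le> 1"
    using nobs_split[OF assms, of s] nobs_except_nonneg[of i s] by auto
qed

text \<open>Integrating out the \<open>i\<close>th data point: on the event that it is observed, the number of observed
  points is \<open>1 + nobs_except i s\<close>, which no longer depends on that point.\<close>

lemma integral_obs_resample:
  assumes i: "i < n"
    and g_meas: "(\<lambda>s. g (fst (s i)) s) \<in> borel_measurable sample"
    and g_meas1: "\<And>s. s \<in> space sample \<Longrightarrow> (\<lambda>x. g x s) \<in> borel_measurable borel"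
    and g_upd: "\<And>x s y. g x (s(i := y)) = g x s"
    and g_bound: "\<And>x s. \<bar>g x s\<bar> \<le> B"
  shows "integrable sample (\<lambda>s. obs (s i) * g (fst (s i)) s / nobs s ^ e)"
    and "(\<integral>s. obs (s i) * g (fst (s i)) s / nobs s ^ e \<partial>sample) =
      (\<integral>s. obs_prob Q * (\<integral>x. g x s \<partial>observed_law) / (1 + nobs_except i s) ^ e \<partial>sample)"
proof -
  let ?f = "\<lambda>s. obs (s i) * g (fst (s i)) s / nobs s ^ e"
  have f [measurable]: "?f \<in> borel_measurable sample"
    using i g_meas by measurable
  have B: "\<bar>?f s\<bar> \<le> B" for s
  proof -
    have "?f s = obs (s i) / nobs s ^ e * g (fst (s i)) s" by simp
    also have "\<bar>\<dots>\<bar> = obs (s i) / nobs s ^ e * \<bar>g (fst (s i)) s\<bar>"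
      using obs_div_nobs_le(1)[OF i, of s e] by (simp only: abs_mult abs_of_nonneg)
    also have "\<dots> \<le> \<bar>g (fst (s i)) s\<bar>"
      using obs_div_nobs_le[OF i, of s e] by (intro mult_left_le_one_le) auto
    finally show ?thesis using g_bound[of "fst (s i)" s] by linarith
  qed
  show "integrable sample ?f"
    using B f by (intro S.P.integrable_const_bound[where B = B]) auto
  have "(\<integral>s. ?f s \<partial>sample) = (\<integral>s. (\<integral>y. ?f (s(i := y)) \<partial>Q) \<partial>sample)"
    using i f B by (intro S.integral_resample) auto
  also have "\<dots> = (\<integral>s. obs_prob Q * (\<integral>x. g x s \<partial>observed_law) / (1 + nobs_except i s) ^ e \<partial>sample)"
  proof (rule Bochner_Integration.integral_cong[OF refl])
    fix s assume s: "s \<in> space sample"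
    \<comment> \<open>If \<open>y\<close> is unobserved both integrands vanish; if it is observed,
      the count is \<open>1 + nobs_except i s\<close>, constant in \<open>y\<close>.\<close>
    have "(\<integral>y. ?f (s(i := y)) \<partial>Q) = (\<integral>y. obs y * g (fst y) s / (1 + nobs_except i s) ^ e \<partial>Q)"
      by (intro Bochner_Integration.integral_cong refl) (auto simp: nobs_upd[OF i] g_upd obs_def)
    also have "\<dots> = obs_prob Q * (\<integral>x. g x s \<partial>observed_law) / (1 + nobs_except i s) ^ e"
      by (simp add: integral_obs_observed_law[OF g_meas1[OF s]])
    finally show "(\<integral>y. ?f (s(i := y)) \<partial>Q) = \<dots>" .
  qed
  finally show "(\<integral>s. ?f s \<partial>sample) = (\<integral>s. obs_prob Q * (\<integral>x. g x s \<partial>observed_law) / (1 + nobs_except i s) ^ e \<partial>sample)" .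
qed

lemma obs_weight:
  assumes "i < n"
  shows "integrable sample (\<lambda>s. obs (s i) / nobs s ^ e)"
    and "(\<integral>s. obs (s i) / nobs s ^ e \<partial>sample) = (\<integral>s. obs_prob Q / (1 + nobs_except i s) ^ e \<partial>sample)"
  using integral_obs_resample[OF assms, of "\<lambda>_ _. 1" 1 e] by (simp_all add: prob_space.prob_space[OF real_distribution.axioms(1)[OF real_distribution_observed_law]])

lemma integrable_divide_power:
  assumes N: "N \<in> borel_measurable sample" "\<And>s. 0 \<le> N s"
  shows "integrable sample (\<lambda>s. c / (1 + N s) ^ e :: real)"
proof (rule S.P.integrable_const_bound[where B = "\<bar>c\<bar>"])
  have "\<bar>c / (1 + N s) ^ e\<bar> \<le> \<bar>c\<bar>" for s
  proof -
    have "1 \<le> (1 + N s) ^ e" using N(2)[of s] by (intro one_le_power) simp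
    moreover from this have "\<bar>c\<bar> / (1 + N s) ^ e \<le> \<bar>c\<bar> / 1"
      by (intro divide_left_mono) auto
    ultimately show ?thesis by (simp add: abs_divide)
  qed
  then show "AE s in sample. norm (c / (1 + N s) ^ e) \<le> \<bar>c\<bar>" by simp
  note [measurable] = N(1)
  show "(\<lambda>s. c / (1 + N s) ^ e) \<in> borel_measurable sample" by measurable
qed

text \<open>Each weight \<open>obs (s i) / nobs s\<close> has expectation at least
  \<open>obs_prob Q\<close> times the left-hand side, since \<open>nobs_except i s\<close> is at
  most \<open>nobs s\<close>, while the \<open>n\<close> weights sum to at most 1.\<close>

lemma integral_inverse_nobs_le: "(\<integral>s. 1 / (1 + nobs s) \<partial>sample) \<le> 1 / (n * obs_prob Q)"
proof -
  let ?I = "\<integral>s. 1 / (1 + nobs s) \<partial>sample"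
  have int: "integrable sample (\<lambda>s. c / (1 + nobs s))" "integrable sample (\<lambda>s. c / (1 + nobs_except i s))"
    for c i
    using integrable_divide_power[OF nobs_measurable nobs_nonneg, of c 1]
      integrable_divide_power[OF nobs_except_measurable nobs_except_nonneg, of c i 1] by simp_all
  have "n * (obs_prob Q * ?I) = (\<Sum>i<n. obs_prob Q * ?I)" by simp
  also have "\<dots> \<le> (\<Sum>i<n. \<integral>s. obs (s i) / nobs s \<partial>sample)"
  proof (intro sum_mono)
    fix i assume "i \<in> {..<n}"
    hence i: "i < n" by simp
    have "obs_prob Q * ?I = (\<integral>s. obs_prob Q / (1 + nobs s) \<partial>sample)"
      by (simp flip: Bochner_Integration.integral_mult_right_zero)
    also have "\<dots> \<le> (\<integral>s. obs_prob Q / (1 + nobs_except i s) \<partial>sample)"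
    proof (intro integral_mono int divide_left_mono)
      fix s
      show "1 + nobs_except i s \<le> 1 + nobs s" using nobs_split[OF i, of s] obs_bounds[of "s i"] by simp
      show "0 < (1 + nobs s) * (1 + nobs_except i s)"
        using nobs_nonneg[of s] nobs_except_nonneg[of i s] by (intro mult_pos_pos) auto
    qed (use obs_pos in simp)
    also have "\<dots> = (\<integral>s. obs (s i) / nobs s \<partial>sample)"
      using obs_weight(2)[OF i, of 1] by simp
    finally show "obs_prob Q * ?I \<le> \<dots>" .
  qed
  also have "\<dots> = (\<integral>s. (\<Sum>i<n. obs (s i) / nobs s) \<partial>sample)"
    using obs_weight(1)[where e = 1] by (subst Bochner_Integration.integral_sum) auto
  also have "\<dots> \<le> 1"
  proof (rule S.P.integral_le_const)
    show "integrable sample (\<lambda>s. \<Sum>i<n. obs (s i) / nobs s)"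
      using obs_weight(1)[where e = 1] by (intro Bochner_Integration.integrable_sum) auto
    \<comment> \<open>With no observed point the quotient is \<open>0 / 0 = 0\<close>, hence a bound
      by 1 and not an equality.\<close>
    have "(\<Sum>i<n. obs (s i) / nobs s) = nobs s / nobs s" for s
      unfolding sum_divide_distrib[symmetric] by (simp add: nobs_def)
    then show "AE s in sample. (\<Sum>i<n. obs (s i) / nobs s) \<le> 1" by simp
  qed
  finally show ?thesis using obs_pos n_pos by (simp add: field_simps)
qed

text \<open>When some point is observed, this is the squared MMD between the empirical law of the observed
  points and \<open>observed_law\<close>. The indicator covers samples without observed points, where
  \<open>2 * sqrt (emp_error s)\<close> is the trivial bound on the MMD.\<close>

definition emp_error :: "(nat \<Rightarrow> real \<times> nat) \<Rightarrow> real" where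
  "emp_error s = of_bool (nobs s = 0) + (\<Sum>i<n. \<Sum>j<n.
     obs (s i) * (obs (s j) * kcentered observed_law (fst (s i)) (fst (s j))) / (nobs s)\<^sup>2)"

text \<open>Given that point \<open>i\<close> is observed, the random denominator does not depend on
  its position and leaves the integral over that point. For distinct \<open>i\<close> and
  \<open>j\<close> what remains is the mean of a centred kernel, which is zero; for
  \<open>i = j\<close> it is the feature variance, at most 1.\<close>

lemma integral_emp_error_term:
  assumes i: "i < n" and j: "j < n"
  defines "f \<equiv> \<lambda>s. obs (s i) * (obs (s j) * kcentered observed_law (fst (s i)) (fst (s j))) / (nobs s)\<^sup>2"
  shows "integrable sample f"
    and "(\<integral>s. f s \<partial>sample) \<le> (if i = j then \<integral>s. obs (s i) / (nobs s)\<^sup>2 \<partial>sample else 0)"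
proof -
  let ?K = "kcentered observed_law"
  note [measurable (raw)] = kcentered_measurable[OF real_distribution_observed_law]
  have "integrable sample f \<and>
      (\<integral>s. f s \<partial>sample) \<le> (if i = j then \<integral>s. obs (s i) / (nobs s)\<^sup>2 \<partial>sample else 0)"
  proof (cases "i = j")
    case True
    define g :: "real \<Rightarrow> (nat \<Rightarrow> real \<times> nat) \<Rightarrow> real" where "g = (\<lambda>x s. ?K x x)"
    \<comment> \<open>\<open>obs\<close> takes only the values 0 and 1, so it equals its
      square.\<close>
    have f: "f = (\<lambda>s. obs (s i) * g (fst (s i)) s / (nobs s)\<^sup>2)"
      unfolding f_def g_def True by (auto simp: fun_eq_iff obs_def)
    note R = integral_obs_resample[of i g 4 2, folded f]
    have int: "integrable sample f"
      and eq: "(\<integral>s. f s \<partial>sample) = (\<integral>s. obs_prob Q * (\<integral>x. ?K x x \<partial>observed_law) / (1 + nobs_except i s)\<^sup>2 \<partial>sample)"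
      using R i kcentered_bound[OF real_distribution_observed_law] by (auto simp: g_def)
    have "(\<integral>s. f s \<partial>sample) \<le> (\<integral>s. obs_prob Q / (1 + nobs_except i s)\<^sup>2 \<partial>sample)"
      unfolding eq using integral_kcentered_diag[OF real_distribution_observed_law] obs_pos
      by (intro integral_mono integrable_divide_power nobs_except_measurable nobs_except_nonneg
          divide_right_mono) (auto intro: mult_left_le)
    \<comment> \<open>Undoing the resampling restores weights whose sum over \<open>i\<close> is
      \<open>1 / nobs s\<close>.\<close>
    also have "\<dots> = (\<integral>s. obs (s i) / (nobs s)\<^sup>2 \<partial>sample)"
      using obs_weight(2)[OF i, of 2] by simp
    finally show ?thesis using int True by simp
  next
    case False
    define g :: "real \<Rightarrow> (nat \<Rightarrow> real \<times> nat) \<Rightarrow> real"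
      where "g = (\<lambda>x s. obs (s j) * ?K x (fst (s j)))"
    have g_bound: "\<bar>g x s\<bar> \<le> 4" for x s
      using kcentered_bound[OF real_distribution_observed_law, of x "fst (s j)"] by (simp add: g_def obs_def)
    have g_meas: "(\<lambda>s. g (fst (s i)) s) \<in> borel_measurable sample"
      unfolding g_def using i j by measurable
    have g_meas1: "(\<lambda>x. g x s) \<in> borel_measurable borel" for s
      unfolding g_def by measurable
    have g_upd: "g x (s(i := y)) = g x s" for x s y
      using False by (simp add: g_def)
    have f: "f = (\<lambda>s. obs (s i) * g (fst (s i)) s / (nobs s)\<^sup>2)"
      unfolding f_def g_def ..
    have "(\<integral>x. g x s \<partial>observed_law) = 0" for s
      using integral_kcentered[OF real_distribution_observed_law] by (simp add: g_def)
    with integral_obs_resample[OF i g_meas g_meas1 g_upd g_bound, of 2] False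
    show ?thesis unfolding f by simp
  qed
  then show "integrable sample f"
    and "(\<integral>s. f s \<partial>sample) \<le> (if i = j then \<integral>s. obs (s i) / (nobs s)\<^sup>2 \<partial>sample else 0)"
    by auto
qed

lemma integrable_no_obs: "integrable sample (\<lambda>s. of_bool (nobs s = 0) :: real)"
  by (intro S.P.integrable_const_bound[where B = 1]) auto

lemma integrable_emp_error: "integrable sample emp_error"
  unfolding emp_error_def using integrable_no_obs integral_emp_error_term(1)
  by (intro Bochner_Integration.integrable_add Bochner_Integration.integrable_sum) auto

lemma integral_emp_error_le: "(\<integral>s. emp_error s \<partial>sample) \<le> 2 / (n * obs_prob Q)"
proof -
  let ?o = "\<lambda>s. of_bool (nobs s = 0) :: real"
  let ?f = "\<lambda>i j s. obs (s i) * (obs (s j) * kcentered observed_law (fst (s i)) (fst (s j))) / (nobs s)\<^sup>2"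
  have w: "integrable sample (\<lambda>s. obs (s i) / (nobs s)\<^sup>2)" if "i < n" for i
    using obs_weight(1)[OF that, of 2] .
  have inner: "integrable sample (\<lambda>s. \<Sum>j<n. ?f i j s)" if "i < n" for i
    using integral_emp_error_term(1)[OF that] by (intro Bochner_Integration.integrable_sum) auto
  have "(\<integral>s. emp_error s \<partial>sample) = (\<integral>s. ?o s \<partial>sample) + (\<integral>s. (\<Sum>i<n. \<Sum>j<n. ?f i j s) \<partial>sample)"
    unfolding emp_error_def using integrable_no_obs integral_emp_error_term(1)
    by (intro Bochner_Integration.integral_add Bochner_Integration.integrable_sum) auto
  also have "(\<integral>s. (\<Sum>i<n. \<Sum>j<n. ?f i j s) \<partial>sample) = (\<Sum>i<n. \<integral>s. (\<Sum>j<n. ?f i j s) \<partial>sample)"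
    using inner by (intro Bochner_Integration.integral_sum) auto
  also have "\<dots> = (\<Sum>i<n. \<Sum>j<n. \<integral>s. ?f i j s \<partial>sample)"
    using integral_emp_error_term(1) by (intro sum.cong refl Bochner_Integration.integral_sum) auto
  finally have "(\<integral>s. emp_error s \<partial>sample) = (\<integral>s. ?o s \<partial>sample) + (\<Sum>i<n. \<Sum>j<n. \<integral>s. ?f i j s \<partial>sample)" .
  also have "\<dots> \<le> (\<integral>s. ?o s \<partial>sample) +
      (\<Sum>i<n. \<Sum>j<n. if i = j then \<integral>s. obs (s i) / (nobs s)\<^sup>2 \<partial>sample else 0)"
    using integral_emp_error_term(2) by (intro add_left_mono sum_mono) auto
  also have "\<dots> = (\<integral>s. ?o s \<partial>sample) + (\<Sum>i<n. \<integral>s. obs (s i) / (nobs s)\<^sup>2 \<partial>sample)"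
    by simp
  also have "\<dots> = (\<integral>s. ?o s + (\<Sum>i<n. obs (s i) / (nobs s)\<^sup>2) \<partial>sample)"
    using integrable_no_obs w
    by (subst Bochner_Integration.integral_add)
      (auto intro!: Bochner_Integration.integrable_sum Bochner_Integration.integral_sum[symmetric])
  \<comment> \<open>With \<open>N\<close> observed points the integrand is 1 if \<open>N = 0\<close>
    and \<open>1 / N\<close> otherwise. Both are at most \<open>2 / (1 + N)\<close>, as
    \<open>N\<close> is an integer.\<close>
  also have "\<dots> \<le> (\<integral>s. 2 * (1 / (1 + nobs s)) \<partial>sample)"
  proof (rule integral_mono)
    show "integrable sample (\<lambda>s. ?o s + (\<Sum>i<n. obs (s i) / (nobs s)\<^sup>2))"
      using integrable_no_obs w
      by (intro Bochner_Integration.integrable_add Bochner_Integration.integrable_sum) auto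
    show "integrable sample (\<lambda>s. 2 * (1 / (1 + nobs s)))"
      using nobs_nonneg
      by (intro S.P.integrable_const_bound[where B = 2]) (auto simp: divide_le_eq)
    fix s
    have "(\<Sum>i<n. obs (s i) / (nobs s)\<^sup>2) = nobs s / (nobs s)\<^sup>2"
      by (simp add: nobs_def sum_divide_distrib)
    moreover have "nobs s = 0 \<or> nobs s \<ge> 1"
      using nobs_eq_card[of s] by (cases "card {i. i < n \<and> snd (s i) = 0}") simp_all
    ultimately show "?o s + (\<Sum>i<n. obs (s i) / (nobs s)\<^sup>2) \<le> 2 * (1 / (1 + nobs s))"
      by (auto simp: field_simps power2_eq_square)
  qed
  also have "\<dots> \<le> 2 * (1 / (n * obs_prob Q))"
    unfolding Bochner_Integration.integral_mult_right_zero
    by (intro mult_left_mono integral_inverse_nobs_le) simp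
  finally show ?thesis by simp
qed

section \<open>From the empirical error to the estimator\<close>

lemma emp_error_no_obs:
  assumes "{i. i < n \<and> snd (s i) = 0} = {}"
  shows "emp_error s = 1"
proof -
  have "obs (s i) = 0" if "i < n" for i using assms that by (auto simp: obs_def)
  then show ?thesis using assms unfolding emp_error_def nobs_eq_card by simp
qed

lemma emp_error_eq_mmd_sq:
  assumes I: "I = {i. i < n \<and> snd (s i) = 0}" "I \<noteq> {}"
  shows "emp_error s = mmd_sq k (empirical I (\<lambda>i. fst (s i))) observed_law"
proof -
  have fin: "finite I" using I by simp
  have N: "nobs s = card I" "nobs s \<noteq> 0"
    using I fin by (auto simp: nobs_eq_card)
  have obs_sum: "(\<Sum>i<n. obs (s i) * h i) = (\<Sum>i\<in>I. h i)" for h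
    unfolding I(1) obs_def by (rule sum.mono_neutral_cong_right) auto
  have "emp_error s = (\<Sum>i<n. obs (s i) * (\<Sum>j<n. obs (s j) * kcentered observed_law (fst (s i)) (fst (s j)))) / (nobs s)\<^sup>2"
    unfolding emp_error_def using N(2) by (simp add: sum_divide_distrib sum_distrib_left)
  then show ?thesis
    unfolding mmd_sq_empirical[OF fin I(2) real_distribution_observed_law] obs_sum N(1) .
qed

lemma emp_error_nonneg: "0 \<le> emp_error s"
  using emp_error_no_obs[of s] emp_error_eq_mmd_sq[of _ s]
    mmd_sq_nonneg[OF real_distribution_empirical real_distribution_observed_law]
  by (cases "{i. i < n \<and> snd (s i) = 0} = {}") auto

text \<open>A bound for every single sample, whose randomness enters the right-hand side only
  through \<open>emp_error s\<close>. The factor 2 arises because both \<open>P \<theta>\<close> and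
  \<open>P \<theta>'\<close> are compared with \<open>marg_X Q\<close> by way of the empirical
  law.\<close>

lemma mmd_estimator_le:
  assumes P: "real_distribution (P \<theta>)" "real_distribution (P \<theta>')"
    and le: "mmd_objective k P n s \<theta> \<le> mmd_objective k P n s \<theta>'"
  shows "mmd k (P \<theta>) (marg_X Q) \<le>
    mmd k (P \<theta>') (marg_X Q) + 2 * (mmd k observed_law (marg_X Q) + sqrt (emp_error s))"
proof -
  define I where "I = {i. i < n \<and> snd (s i) = 0}"
  let ?E = "empirical I (\<lambda>i. fst (s i))" and ?X = "marg_X Q"
  note X = PX.real_distribution_axioms and E = real_distribution_empirical[of I "\<lambda>i. fst (s i)"]
  show ?thesis
  proof (cases "I = {}")
    case True
    have "mmd k (P \<theta>) ?X \<le> 2"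
      using P(1) X by (intro mmd_le_2) (auto simp: real_distribution_def)
    moreover have "emp_error s = 1" using True emp_error_no_obs by (simp add: I_def)
    ultimately show ?thesis
      using mmd_nonneg[OF P(2) X] mmd_nonneg[OF real_distribution_observed_law X] by simp
  next
    case False
    have "mmd k (P \<theta>) ?X \<le> mmd k (P \<theta>) ?E + mmd k ?E ?X"
      by (rule mmd_triangle[OF P(1) E X])
    also have "mmd k (P \<theta>) ?E \<le> mmd k (P \<theta>') ?E"
      by (rule mmd_empirical_le_of_mmd_objective_le[OF I_def False P le])
    also have "\<dots> \<le> mmd k (P \<theta>') ?X + mmd k ?E ?X"
      using mmd_triangle[OF P(2) X E] mmd_commute[OF X E] by simp
    also have "mmd k ?E ?X \<le> mmd k ?E observed_law + mmd k observed_law ?X"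
      by (rule mmd_triangle[OF E real_distribution_observed_law X])
    also have "mmd k ?E observed_law = sqrt (emp_error s)"
      unfolding mmd_def emp_error_eq_mmd_sq[OF I_def False] ..
    finally show ?thesis by simp
  qed
qed

end

theorem theorem7:
  fixes k :: "real \<Rightarrow> real \<Rightarrow> real"
    and Q :: "(real \<times> nat) measure"
    and pix :: "real \<Rightarrow> real"
    and P :: "'p \<Rightarrow> real measure"
    and \<Theta> :: "'p set"
    and n :: nat
    and est :: "(nat \<Rightarrow> real \<times> nat) \<Rightarrow> 'p"
  assumes k_pd: "pd_kernel k"
    and k_meas: "(\<lambda>(x, y). k x y) \<in> borel_measurable (borel \<Otimes>\<^sub>M borel)"
    and k_bdd: "\<forall>x y. \<bar>k x y\<bar> \<le> 1"
    and k_char: "characteristic_kernel k"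
    and Q_prob: "prob_space Q"
    and Q_sets: "sets Q = sets (borel \<Otimes>\<^sub>M count_space {0, 1})"
    and pix_meas: "pix \<in> borel_measurable borel"
    and pix_int: "integrable (marg_X Q) pix"
    and pix_cond: "\<forall>A \<in> sets borel. measure Q (A \<times> {0}) = (LINT x:A | marg_X Q. pix x)"
    and obs_pos: "obs_prob Q > 0"
    and model: "\<forall>\<theta> \<in> \<Theta>. prob_space (P \<theta>) \<and> sets (P \<theta>) = sets borel"
    and n_pos: "n \<ge> 1"
    and est_min: "\<forall>s \<in> space (PiM {..<n} (\<lambda>_. Q)).
        est s \<in> \<Theta> \<and> (\<forall>\<theta> \<in> \<Theta>. mmd_objective k P n s (est s) \<le> mmd_objective k P n s \<theta>)"
    and est_meas: "(\<lambda>s. mmd k (P (est s)) (marg_X Q)) \<in> borel_measurable (PiM {..<n} (\<lambda>_. Q))"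
  shows "(\<integral>s. mmd k (P (est s)) (marg_X Q) \<partial>(PiM {..<n} (\<lambda>_. Q)))
      \<le> (INF \<theta> \<in> \<Theta>. mmd k (P \<theta>) (marg_X Q))
         + 2 * sqrt (\<integral>x. (pix x - obs_prob Q)\<^sup>2 \<partial>(marg_X Q)) / obs_prob Q
         + 2 * sqrt 2 / sqrt (real n * obs_prob Q)"
proof -
  interpret missing_data_sample Q pix k n
    by (intro missing_data_sample.intro missing_data_kernel.intro missing_data.intro
        missing_data_axioms.intro missing_data_sample_axioms.intro bounded_pd_kernel.intro)
      (use assms in auto)
  let ?X = "marg_X Q"
  define V where "V = sqrt (\<integral>x. (pix x - obs_prob Q)\<^sup>2 \<partial>?X) / obs_prob Q"
  \<comment> \<open>\<open>c^2\<close> is exactly the bound on the expectation of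
    \<open>emp_error\<close>, as \<open>expectation_sqrt_le\<close> demands.\<close>
  define c where "c = sqrt 2 / sqrt (n * obs_prob Q)"
  have X: "real_distribution ?X" by (rule PX.real_distribution_axioms)
  have P: "real_distribution (P \<theta>)" if "\<theta> \<in> \<Theta>" for \<theta>
    using model that by (simp add: real_distribution_def real_distribution_axioms_def)
  have np: "0 < n * obs_prob Q" using n_pos obs_pos by simp
  have c: "0 < c" "c\<^sup>2 = 2 / (n * obs_prob Q)"
    using np by (simp_all add: c_def power_divide)
  have sqrt_int: "integrable sample (\<lambda>s. sqrt (emp_error s))"
    and sqrt_le: "(\<integral>s. sqrt (emp_error s) \<partial>sample) \<le> c"
    using S.P.expectation_sqrt_le[OF integrable_emp_error emp_error_nonneg _ c(1)]
      integral_emp_error_le c(2) by auto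
  have mmd_bound: "norm (mmd k (P (est s)) ?X) \<le> 2" if "s \<in> space sample" for s
    using P[of "est s"] est_min that X mmd_nonneg[of "P (est s)" ?X]
    by (auto intro!: mmd_le_2 simp: real_distribution_def)
  have est_int: "integrable sample (\<lambda>s. mmd k (P (est s)) ?X)"
    using mmd_bound est_meas by (intro S.P.integrable_const_bound[where B = 2]) auto
  \<comment> \<open>The left-hand side does not involve \<open>\<theta>\<close>, so the infimum can
    be taken last, attained or not.\<close>
  have "(\<integral>s. mmd k (P (est s)) ?X \<partial>sample) - 2 * V - 2 * c \<le> mmd k (P \<theta>) ?X" if \<theta>: "\<theta> \<in> \<Theta>" for \<theta>
  proof -
    have "(\<integral>s. mmd k (P (est s)) ?X \<partial>sample) \<le>
        (\<integral>s. (mmd k (P \<theta>) ?X + 2 * V) + 2 * sqrt (emp_error s) \<partial>sample)"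
    proof (rule integral_mono)
      fix s assume "s \<in> space sample"
      with est_min \<theta> have "est s \<in> \<Theta>" "mmd_objective k P n s (est s) \<le> mmd_objective k P n s \<theta>"
        by auto
      from mmd_estimator_le[OF P[OF this(1)] P[OF \<theta>] this(2)] mmd_observed_law_le[folded V_def]
      show "mmd k (P (est s)) ?X \<le> (mmd k (P \<theta>) ?X + 2 * V) + 2 * sqrt (emp_error s)"
        by (simp add: algebra_simps)
    qed (use est_int sqrt_int in auto)
    also have "\<dots> = (mmd k (P \<theta>) ?X + 2 * V) + 2 * (\<integral>s. sqrt (emp_error s) \<partial>sample)"
      using sqrt_int S.P.prob_space by simp
    finally show ?thesis using sqrt_le by linarith
  qed
  \<comment> \<open>The sample space is nonempty and \<open>est\<close> maps it into
    \<open>\<Theta>\<close>; the infimum of an empty set of reals would carry no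
    information.\<close>
  moreover have "\<Theta> \<noteq> {}" using est_min S.P.not_empty by auto
  ultimately have "(\<integral>s. mmd k (P (est s)) ?X \<partial>sample) - 2 * V - 2 * c \<le> (INF \<theta>\<in>\<Theta>. mmd k (P \<theta>) ?X)"
    by (intro cINF_greatest)
  then show ?thesis by (simp add: c_def V_def)
qed

end
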